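(* Let $A\in\mathbb{R}^{m\times n}$ with $m<n$ have full row rank and let $b\in\mathbb{R}^m$, $b\neq 0$. Let $x^*$ and $x^0$ be optimal solutions to $(FP_a)$: $\min_{x\in\mathbb{R}^n}P_a(x)$ subject to $Ax=b$, and to $(P_0)$: $\min_{x\in\mathbb{R}^n}\|x\|_0$ subject to $Ax=b$, respectively, and let $T=\mathrm{supp}(x^0)=\{i : x^0_i\neq 0\}$. Suppose there is an integer $K>|T|$ with $K+|T|\le m$, $\delta_{K+|T|}<1$ and $$K>|T|\,\frac{1+\delta_K}{1-\delta_{K+|T|}}.$$ Then there exists $a^*>1$ (depending on the matrix $A$) such that for any $1<a<a^*$, the optimal solution $x^*$ to $(FP_a)$ is unique and $x^*=x^0$.
   Context: For $a>0$ and $x\in\mathbb{R}^n$, $P_a(x)=\sum_{i=1}^n p_a(x_i)$ with $p_a(t)=\frac{a|t|}{1+a|t|}$. $\|x\|_0$ denotes the number of nonzero entries of $x$. Restricted isometry constants: for each integer $1\le s\le m$, $\delta_s$ is the smallest number such that for every set $S$ of at most $s$ column indices, the submatrix $A_S$ of $A$ formed by the columns indexed by $S$ satisfies $$(1-\delta_s)\|c\|_2^2\le\|A_Sc\|_2^2\le(1+\delta_s)\|c\|_2^2\quad\text{for all } c\in\mathbb{R}^{|S|}.$$ *)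

theory Defs
  imports "HOL-Analysis.Analysis"
begin

definition frac_pen :: "real \<Rightarrow> real \<Rightarrow> real" where
  "frac_pen a t = a * \<bar>t\<bar> / (1 + a * \<bar>t\<bar>)"

definition frac_penalty :: "real \<Rightarrow> real ^ 'n \<Rightarrow> real" where
  "frac_penalty a x = (\<Sum>i\<in>UNIV. frac_pen a (x $ i))"

definition supp :: "real ^ 'n \<Rightarrow> 'n set" where
  "supp x = {i. x $ i \<noteq> 0}"

definition l0_norm :: "real ^ 'n \<Rightarrow> nat" where
  "l0_norm x = card (supp x)"

definition optimal_FP :: "real ^ 'n ^ 'm \<Rightarrow> real ^ 'm \<Rightarrow> real \<Rightarrow> real ^ 'n \<Rightarrow> bool" where
  "optimal_FP A b a = is_arg_min (frac_penalty a) (\<lambda>x. A *v x = b)"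

definition optimal_P0 :: "real ^ 'n ^ 'm \<Rightarrow> real ^ 'm \<Rightarrow> real ^ 'n \<Rightarrow> bool" where
  "optimal_P0 A b = is_arg_min l0_norm (\<lambda>x. A *v x = b)"

(* The submatrix of the columns indexed by S, applied to a coefficient vector c indexed by S;
   the values of c outside S are irrelevant. *)
definition submatrix_mult :: "real ^ 'n ^ 'm \<Rightarrow> 'n set \<Rightarrow> ('n \<Rightarrow> real) \<Rightarrow> real ^ 'm" where
  "submatrix_mult A S c = (\<Sum>j\<in>S. c j *\<^sub>R column j A)"

definition rip_bound :: "real ^ 'n ^ 'm \<Rightarrow> nat \<Rightarrow> real \<Rightarrow> bool" where
  "rip_bound A s d \<longleftrightarrow> (\<forall>S. card S \<le> s \<longrightarrow> (\<forall>c.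
     (1 - d) * (\<Sum>j\<in>S. (c j)\<^sup>2) \<le> (norm (submatrix_mult A S c))\<^sup>2 \<and>
     (norm (submatrix_mult A S c))\<^sup>2 \<le> (1 + d) * (\<Sum>j\<in>S. (c j)\<^sup>2)))"

(* Meaningful only for s \<ge> 1: for s = 0 every d is a bound and there is no least one. *)
definition rip_const :: "real ^ 'n ^ 'm \<Rightarrow> nat \<Rightarrow> real" where
  "rip_const A s = (LEAST d. rip_bound A s d)"

end

theory Submission imports Defs begin

text \<open>The restricted isometry hypothesis yields the \<open>\<ell>\<^sub>1\<close> null space property: for every nonzero
  \<open>h\<close> in the kernel of \<open>A\<close> and every index set \<open>V\<close> of size \<open>|T|\<close>, the \<open>\<ell>\<^sub>1\<close> mass of \<open>h\<close> on \<open>V\<close> is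
  smaller than the mass off \<open>V\<close>. To see this, split the complement of \<open>V\<close> into blocks of size \<open>K\<close>
  of decreasing magnitude.
  Since \<open>p\<^sub>a(t) / |t|\<close> decreases in \<open>|t|\<close>, the property passes from \<open>\<ell>\<^sub>1\<close> to \<open>P\<^sub>a\<close> when \<open>V\<close>
  carries the largest entries of \<open>h\<close>, and then to all sets of size \<open>|T|\<close> because \<open>p\<^sub>a\<close> is monotone.
  As \<open>p\<^sub>a\<close> is subadditive, \<open>x\<^sup>0\<close> is the only minimiser for every \<open>a > 0\<close>; hence any \<open>a\<^sup>* > 1\<close>
  will do.\<close>

section \<open>The restricted isometry constant\<close>

text \<open>\<open>rip_const\<close> is a LEAST, so some bound has to exist. For
  \<open>d = 1 + B\<close> the lower estimate is trivial because \<open>1 - d = - B\<close>, and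
  Cauchy-Schwarz over the columns gives the upper one.\<close>

lemma rip_bound_exists:
  fixes A :: "real ^ 'n ^ 'm"
  shows "\<exists>d. rip_bound A s d"
proof -
  define B where "B = (\<Sum>j\<in>UNIV. (norm (column j A))\<^sup>2)"
  have "rip_bound A s (1 + B)"
    unfolding rip_bound_def
  proof (intro allI impI conjI)
    fix S :: "'n set" and c :: "'n \<Rightarrow> real"
    have X: "0 \<le> (\<Sum>j\<in>S. (c j)\<^sup>2)" by (simp add: sum_nonneg)
    have B: "0 \<le> B" by (simp add: B_def sum_nonneg)
    have "(1 - (1 + B)) * (\<Sum>j\<in>S. (c j)\<^sup>2) \<le> 0"
      using X B by simp
    then show "(1 - (1 + B)) * (\<Sum>j\<in>S. (c j)\<^sup>2) \<le> (norm (submatrix_mult A S c))\<^sup>2"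
      by (rule order_trans) simp
    have "norm (submatrix_mult A S c) \<le> (\<Sum>j\<in>S. \<bar>c j\<bar> * norm (column j A))"
      unfolding submatrix_mult_def by (rule sum_norm_le) simp
    then have "(norm (submatrix_mult A S c))\<^sup>2 \<le> (\<Sum>j\<in>S. \<bar>c j\<bar> * norm (column j A))\<^sup>2"
      by (simp add: power_mono)
    also have "\<dots> \<le> (\<Sum>j\<in>S. \<bar>c j\<bar>\<^sup>2) * (\<Sum>j\<in>S. (norm (column j A))\<^sup>2)"
      by (rule Cauchy_Schwarz_ineq_sum)
    also have "\<dots> \<le> (\<Sum>j\<in>S. (c j)\<^sup>2) * B"
      unfolding B_def power2_abs using X by (intro mult_left_mono sum_mono2) auto
    also have "\<dots> \<le> (1 + (1 + B)) * (\<Sum>j\<in>S. (c j)\<^sup>2)"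
      using X by (simp add: algebra_simps)
    finally show "(norm (submatrix_mult A S c))\<^sup>2 \<le> (1 + (1 + B)) * (\<Sum>j\<in>S. (c j)\<^sup>2)" .
  qed
  then show ?thesis by blast
qed

text \<open>Test with one column and coefficient 1. The result bounds the set of admissible
  \<open>d\<close> from below and later makes \<open>sqrt (1 + d)\<close> a genuine root.\<close>

lemma rip_bound_ge_minus_one:
  fixes A :: "real ^ 'n ^ 'm"
  assumes "rip_bound A s d" "1 \<le> s"
  shows "-1 \<le> d"
proof -
  let ?S = "{undefined :: 'n}"
  have "(norm (submatrix_mult A ?S (\<lambda>_. 1)))\<^sup>2 \<le> (1 + d) * (\<Sum>j\<in>?S. 1\<^sup>2)"
    using assms(1)[unfolded rip_bound_def, rule_format, of ?S "\<lambda>_. 1"] assms(2) by simp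
  also have "(1 + d) * (\<Sum>j\<in>?S. 1\<^sup>2) = 1 + d" by simp
  finally have "0 \<le> 1 + d" by (rule order_trans[OF zero_le_power2])
  then show ?thesis by simp
qed

text \<open>A LEAST over the reals exists only if the infimum is attained. It is, because every
  restricted isometry inequality is a closed condition on \<open>d\<close>.\<close>

lemma rip_bound_rip_const:
  fixes A :: "real ^ 'n ^ 'm"
  assumes "1 \<le> s"
  shows "rip_bound A s (rip_const A s)"
proof -
  define D where "D = {d. rip_bound A s d}"
  have ne: "D \<noteq> {}" using rip_bound_exists[of A s] by (auto simp: D_def)
  have bdd: "bdd_below D"
    using rip_bound_ge_minus_one[OF _ assms] by (auto simp: D_def intro!: bdd_belowI[of _ "-1"])
  have "rip_bound A s (Inf D)"
    unfolding rip_bound_def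
  proof (intro allI impI)
    fix S :: "'n set" and c :: "'n \<Rightarrow> real"
    assume S: "card S \<le> s"
    define X where "X = (\<Sum>j\<in>S. (c j)\<^sup>2)"
    define Y where "Y = (norm (submatrix_mult A S c))\<^sup>2"
    have D: "(1 - d) * X \<le> Y" "Y \<le> (1 + d) * X" if "d \<in> D" for d
      using that S by (auto simp: D_def rip_bound_def X_def Y_def)
    have "0 \<le> X" by (simp add: X_def sum_nonneg)
    \<comment> \<open>For \<open>X = 0\<close> the inequalities no longer depend on
      \<open>d\<close>, so any element of \<open>D\<close> proves them. For \<open>0 < X\<close>
      they are lower bounds on \<open>d\<close> and pass to the infimum.\<close>
    then consider "X = 0" | "0 < X" by linarith
    then have "(1 - Inf D) * X \<le> Y \<and> Y \<le> (1 + Inf D) * X"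
    proof cases
      case 1
      then show ?thesis using D ne by auto
    next
      case 2
      have "1 - Y / X \<le> d" "Y / X - 1 \<le> d" if "d \<in> D" for d
        using D[OF that] 2 by (simp_all add: field_simps)
      then have "1 - Y / X \<le> Inf D" "Y / X - 1 \<le> Inf D"
        by (auto intro!: cInf_greatest[OF ne])
      then show ?thesis using 2 by (simp add: field_simps)
    qed
    then show "(1 - Inf D) * (\<Sum>j\<in>S. (c j)\<^sup>2) \<le> (norm (submatrix_mult A S c))\<^sup>2 \<and>
        (norm (submatrix_mult A S c))\<^sup>2 \<le> (1 + Inf D) * (\<Sum>j\<in>S. (c j)\<^sup>2)"
      by (simp add: X_def Y_def)
  qed
  then show ?thesis
    unfolding rip_const_def
    by (rule LeastI2_order) (use bdd in \<open>auto simp: D_def intro: cInf_lower\<close>)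
qed

section \<open>Largest entries\<close>

text \<open>Greedy selection: each step adds a largest remaining element, whose value becomes the
  new threshold \<open>\<tau>\<close>. The threshold replaces a sorting of the entries.\<close>

lemma exists_top_subset:
  fixes g :: "'a \<Rightarrow> real"
  assumes "finite U" "k \<le> card U" "\<And>i. i \<in> U \<Longrightarrow> 0 \<le> g i"
  shows "\<exists>V \<tau>. V \<subseteq> U \<and> card V = k \<and> 0 \<le> \<tau> \<and> (\<forall>i\<in>V. \<tau> \<le> g i) \<and> (\<forall>i\<in>U - V. g i \<le> \<tau>)"
  using assms(2)
proof (induction k)
  case 0
  \<comment> \<open>The threshold of the empty selection has to dominate all of \<open>U\<close>;
    the sum does, and unlike a maximum it also makes sense for empty \<open>U\<close>.\<close>
  have "\<forall>i\<in>U. g i \<le> sum g U" using assms by (auto intro: member_le_sum)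
  moreover have "0 \<le> sum g U" using assms(3) by (rule sum_nonneg)
  ultimately show ?case by (intro exI[of _ "{}"] exI[of _ "sum g U"]) auto
next
  case (Suc k)
  then obtain V \<tau> where V: "V \<subseteq> U" "card V = k" "\<forall>i\<in>V. \<tau> \<le> g i" "\<forall>i\<in>U - V. g i \<le> \<tau>"
    by auto
  have fin: "finite (U - V)" "finite V" using assms(1) V(1) finite_subset by auto
  have "U - V \<noteq> {}" using Suc.prems V(1,2) by auto
  then obtain x where x: "x \<in> U - V" "\<forall>i\<in>U - V. g i \<le> g x"
    using arg_min_if_finite[OF fin(1), of "\<lambda>i. - g i"] by (metis neg_less_iff_less not_le)
  have "insert x V \<subseteq> U" "card (insert x V) = Suc k" "0 \<le> g x"
    using V(1,2) x(1) fin(2) assms(3) by auto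
  moreover have "\<forall>i\<in>insert x V. g x \<le> g i"
    using V(3,4) x(1) order_trans by blast
  moreover have "\<forall>i\<in>U - insert x V. g i \<le> g x" using x(2) by blast
  ultimately show ?case by blast
qed

text \<open>The common part cancels; \<open>T - V\<close> and \<open>V - T\<close> have equal size,
  and \<open>\<theta>\<close> separates their values.\<close>

lemma sum_le_sum_top:
  fixes F :: "'a \<Rightarrow> real"
  assumes "finite T" "finite V" "card T = card V"
    and V: "\<And>i. i \<in> V \<Longrightarrow> \<theta> \<le> F i" and T: "\<And>i. i \<in> T - V \<Longrightarrow> F i \<le> \<theta>"
  shows "sum F T \<le> sum F V"
proof -
  have c: "card (T - V) = card (V - T)"
    using assms(1-3) by (simp add: card_Diff_subset_Int Int_commute)
  have "sum F (T - V) \<le> of_nat (card (T - V)) * \<theta>"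
    by (rule sum_bounded_above) (use T in auto)
  also have "\<dots> \<le> sum F (V - T)"
    unfolding c by (rule sum_bounded_below) (use V in auto)
  finally show ?thesis
    using sum.Int_Diff[OF assms(1), of F V] sum.Int_Diff[OF assms(2), of F T]
    by (simp add: Int_commute)
qed

section \<open>The null space property\<close>

lemma sum_sq_le_card:
  fixes h :: "'a \<Rightarrow> real"
  assumes "card U \<le> K" "0 \<le> M" "\<And>i. i \<in> U \<Longrightarrow> \<bar>h i\<bar> \<le> M"
  shows "sqrt (\<Sum>i\<in>U. (h i)\<^sup>2) \<le> sqrt (real K) * M"
proof -
  have "(\<Sum>i\<in>U. (h i)\<^sup>2) \<le> of_nat (card U) * M\<^sup>2"
    using assms(2,3) by (intro sum_bounded_above) (simp add: abs_le_square_iff[symmetric])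
  also have "\<dots> \<le> real K * M\<^sup>2" using assms(1) by (simp add: mult_right_mono)
  finally have "sqrt (\<Sum>i\<in>U. (h i)\<^sup>2) \<le> sqrt (real K * M\<^sup>2)" by simp
  then show ?thesis using assms(2) by (simp add: real_sqrt_mult)
qed

text \<open>The average over a full block is at least its threshold. Hence the bound
  \<open>sqrt (real K) * \<tau>\<close> for the next block can be charged to the l1 mass of this
  one.\<close>

lemma top_block_bound:
  fixes h :: "'a \<Rightarrow> real"
  assumes "card V = K" "0 < K" "\<And>i. i \<in> V \<Longrightarrow> \<tau> \<le> \<bar>h i\<bar>"
  shows "sqrt (real K) * \<tau> \<le> (\<Sum>i\<in>V. \<bar>h i\<bar>) / sqrt (real K)"
proof -
  have "of_nat (card V) * \<tau> \<le> (\<Sum>i\<in>V. \<bar>h i\<bar>)" using assms(3) by (rule sum_bounded_below)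
  then have "real K * \<tau> / sqrt (real K) \<le> (\<Sum>i\<in>V. \<bar>h i\<bar>) / sqrt (real K)"
    using assms(1) by (simp add: divide_right_mono)
  moreover have "sqrt (real K) * \<tau> = real K * \<tau> / sqrt (real K)"
    by (metis real_div_sqrt times_divide_eq_left of_nat_0_le_iff)
  ultimately show ?thesis by (simp only:)
qed

text \<open>Peel off the \<open>K\<close> largest entries: this block costs at most the
  \<open>M\<close> term, and the remainder is handled by induction with \<open>\<tau>\<close> in
  place of \<open>M\<close>. The resulting \<open>\<tau>\<close> term is charged to the removed
  block, so each block pays for its successor.\<close>

lemma norm_sum_blocks_le:
  fixes v :: "'a \<Rightarrow> 'b::real_normed_vector" and h :: "'a \<Rightarrow> real"
  assumes K: "0 < K" and C: "0 \<le> C"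
    and upper: "\<And>S. card S \<le> K \<Longrightarrow> norm (\<Sum>i\<in>S. h i *\<^sub>R v i) \<le> C * sqrt (\<Sum>i\<in>S. (h i)\<^sup>2)"
    and U: "finite U" "0 \<le> M" "\<And>i. i \<in> U \<Longrightarrow> \<bar>h i\<bar> \<le> M"
  shows "norm (\<Sum>i\<in>U. h i *\<^sub>R v i) \<le> C * (sqrt (real K) * M + (\<Sum>i\<in>U. \<bar>h i\<bar>) / sqrt (real K))"
  using U
proof (induction "card U" arbitrary: U M rule: less_induct)
  case less
  have block: "norm (\<Sum>i\<in>V. h i *\<^sub>R v i) \<le> C * (sqrt (real K) * M)" if "V \<subseteq> U" "card V \<le> K" for V
    using that less.prems by (intro order_trans[OF upper mult_left_mono[OF sum_sq_le_card C]]) auto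
  show ?case
  proof (cases "card U \<le> K")
    case True
    have "0 \<le> C * ((\<Sum>i\<in>U. \<bar>h i\<bar>) / sqrt (real K))"
      using C by (simp add: sum_nonneg)
    then show ?thesis using block[OF order_refl True] by (simp add: distrib_left)
  next
    case False
    then obtain V \<tau> where V: "V \<subseteq> U" "card V = K" "0 \<le> \<tau>"
        "\<forall>i\<in>V. \<tau> \<le> \<bar>h i\<bar>" "\<forall>i\<in>U - V. \<bar>h i\<bar> \<le> \<tau>"
      using exists_top_subset[of U K "\<lambda>i. \<bar>h i\<bar>"] less.prems by auto
    have "card (U - V) < card U"
      using V less.prems(1) False K by (simp add: card_Diff_subset finite_subset)
    then have "norm (\<Sum>i\<in>U - V. h i *\<^sub>R v i)
        \<le> C * (sqrt (real K) * \<tau> + (\<Sum>i\<in>U - V. \<bar>h i\<bar>) / sqrt (real K))"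
      by (rule less.hyps) (use less.prems(1) V in auto)
    also have "\<dots> \<le> C * ((\<Sum>i\<in>V. \<bar>h i\<bar>) / sqrt (real K) + (\<Sum>i\<in>U - V. \<bar>h i\<bar>) / sqrt (real K))"
      using top_block_bound[of V K \<tau> h] V K C by (intro mult_left_mono add_right_mono) auto
    also have "\<dots> = C * ((\<Sum>i\<in>U. \<bar>h i\<bar>) / sqrt (real K))"
      using sum.subset_diff[OF V(1) less.prems(1), of "\<lambda>i. \<bar>h i\<bar>"]
      by (simp add: add_divide_distrib)
    finally have rest: "norm (\<Sum>i\<in>U - V. h i *\<^sub>R v i) \<le> C * ((\<Sum>i\<in>U. \<bar>h i\<bar>) / sqrt (real K))" .
    have "norm (\<Sum>i\<in>U. h i *\<^sub>R v i)
        \<le> norm (\<Sum>i\<in>U - V. h i *\<^sub>R v i) + norm (\<Sum>i\<in>V. h i *\<^sub>R v i)"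
      unfolding sum.subset_diff[OF V(1) less.prems(1)] by (rule norm_triangle_ineq)
    also have "\<dots> \<le> C * ((\<Sum>i\<in>U. \<bar>h i\<bar>) / sqrt (real K)) + C * (sqrt (real K) * M)"
      using rest block[OF V(1)] V(2) by (intro add_mono) auto
    finally show ?thesis by (simp add: distrib_left)
  qed
qed

text \<open>Leaving out the largest block \<open>V\<close> removes the \<open>M\<close> term, since
  the first block of the tail is charged to \<open>V\<close>. If \<open>U\<close> fits into one
  block, the tail is empty.\<close>

lemma norm_sum_tail_le:
  fixes v :: "'a \<Rightarrow> 'b::real_normed_vector" and h :: "'a \<Rightarrow> real"
  assumes K: "0 < K" and C: "0 \<le> C"
    and upper: "\<And>S. card S \<le> K \<Longrightarrow> norm (\<Sum>i\<in>S. h i *\<^sub>R v i) \<le> C * sqrt (\<Sum>i\<in>S. (h i)\<^sup>2)"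
    and U: "finite U"
  shows "\<exists>V\<subseteq>U. card V \<le> K \<and>
    norm (\<Sum>i\<in>U - V. h i *\<^sub>R v i) \<le> C * ((\<Sum>i\<in>U. \<bar>h i\<bar>) / sqrt (real K))"
proof (cases "card U \<le> K")
  case True
  have "0 \<le> C * ((\<Sum>i\<in>U. \<bar>h i\<bar>) / sqrt (real K))" using C by (simp add: sum_nonneg)
  then show ?thesis using True by (intro exI[of _ U]) auto
next
  case False
  then obtain V \<tau> where V: "V \<subseteq> U" "card V = K" "0 \<le> \<tau>"
      "\<forall>i\<in>V. \<tau> \<le> \<bar>h i\<bar>" "\<forall>i\<in>U - V. \<bar>h i\<bar> \<le> \<tau>"
    using exists_top_subset[of U K "\<lambda>i. \<bar>h i\<bar>"] U by auto
  have "norm (\<Sum>i\<in>U - V. h i *\<^sub>R v i)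
      \<le> C * (sqrt (real K) * \<tau> + (\<Sum>i\<in>U - V. \<bar>h i\<bar>) / sqrt (real K))"
    using V U by (intro norm_sum_blocks_le[OF K C upper]) auto
  also have "\<dots> \<le> C * ((\<Sum>i\<in>V. \<bar>h i\<bar>) / sqrt (real K) + (\<Sum>i\<in>U - V. \<bar>h i\<bar>) / sqrt (real K))"
    using top_block_bound[of V K \<tau> h] V K C by (intro mult_left_mono add_right_mono) auto
  also have "\<dots> = C * ((\<Sum>i\<in>U. \<bar>h i\<bar>) / sqrt (real K))"
    using sum.subset_diff[OF V(1) U, of "\<lambda>i. \<bar>h i\<bar>"] by (simp add: add_divide_distrib)
  finally show ?thesis using V by auto
qed

text \<open>Let \<open>W\<close> be the largest block outside \<open>V\<close>. As \<open>h\<close>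
  lies in the kernel, the images of its parts on \<open>V \<union> W\<close> and on the tail are
  opposite. The lower estimate of order \<open>K + t\<close> for the first meets the block bound for
  the second, and Cauchy-Schwarz on \<open>V\<close> turns the l2 norm into
  \<open>P\<close>.\<close>

lemma rip_null_space_property:
  fixes A :: "real ^ 'n ^ 'm" and h :: "real ^ 'n"
  assumes ker: "A *v h = 0" and "h \<noteq> 0"
    and K: "0 < K" and V: "card V = t"
    and d: "rip_bound A K d" and e: "rip_bound A (K + t) e" "e < 1"
    and gap: "real K > real t * ((1 + d) / (1 - e))"
  shows "(\<Sum>i\<in>V. \<bar>h $ i\<bar>) < (\<Sum>i\<in>-V. \<bar>h $ i\<bar>)"
proof -
  define P where "P = (\<Sum>i\<in>V. \<bar>h $ i\<bar>)"
  define Q where "Q = (\<Sum>i\<in>-V. \<bar>h $ i\<bar>)"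
  have PQ: "0 \<le> P" "0 \<le> Q" by (auto simp: P_def Q_def sum_nonneg)
  have d0: "0 \<le> 1 + d" using rip_bound_ge_minus_one[OF d] K by simp
  have upper: "norm (\<Sum>i\<in>S. h $ i *\<^sub>R column i A) \<le> sqrt (1 + d) * sqrt (\<Sum>i\<in>S. (h $ i)\<^sup>2)"
    if "card S \<le> K" for S
  proof -
    have "(norm (\<Sum>i\<in>S. h $ i *\<^sub>R column i A))\<^sup>2 \<le> (1 + d) * (\<Sum>i\<in>S. (h $ i)\<^sup>2)"
      using d that unfolding rip_bound_def submatrix_mult_def by blast
    then show ?thesis unfolding real_sqrt_mult[symmetric] by (rule real_le_rsqrt)
  qed
  obtain W where W: "W \<subseteq> -V" "card W \<le> K"
      "norm (\<Sum>i\<in>-V - W. h $ i *\<^sub>R column i A) \<le> sqrt (1 + d) * (Q / sqrt (real K))"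
    using norm_sum_tail_le[where v = "\<lambda>i. column i A" and h = "\<lambda>i. h $ i" and U = "-V", OF K _ upper] d0
    unfolding Q_def by auto
  define S where "S = V \<union> W"
  have S: "card S \<le> K + t" using card_Un_le[of V W] V W(2) by (simp add: S_def)
  have "(\<Sum>i\<in>UNIV. h $ i *\<^sub>R column i A) = 0"
    using ker by (simp add: matrix_mult_sum scalar_mult_eq_scaleR)
  moreover have "UNIV - S = -V - W" by (auto simp: S_def)
  ultimately have "(\<Sum>i\<in>-V - W. h $ i *\<^sub>R column i A) + (\<Sum>i\<in>S. h $ i *\<^sub>R column i A) = 0"
    using sum.subset_diff[of S UNIV "\<lambda>i. h $ i *\<^sub>R column i A"] by simp
  then have "(\<Sum>i\<in>-V - W. h $ i *\<^sub>R column i A) = - (\<Sum>i\<in>S. h $ i *\<^sub>R column i A)"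
    by (simp only: eq_neg_iff_add_eq_0)
  then have "norm (\<Sum>i\<in>-V - W. h $ i *\<^sub>R column i A) = norm (\<Sum>i\<in>S. h $ i *\<^sub>R column i A)"
    by (simp only: norm_minus_cancel)
  then have "(norm (\<Sum>i\<in>S. h $ i *\<^sub>R column i A))\<^sup>2 \<le> (sqrt (1 + d) * (Q / sqrt (real K)))\<^sup>2"
    using W(3) by (simp add: power_mono)
  also have "\<dots> = (1 + d) * Q\<^sup>2 / real K"
    using d0 K by (simp add: power_mult_distrib power_divide)
  finally have up: "(norm (\<Sum>i\<in>S. h $ i *\<^sub>R column i A))\<^sup>2 \<le> (1 + d) * Q\<^sup>2 / real K" .
  have low: "(1 - e) * (\<Sum>i\<in>S. (h $ i)\<^sup>2) \<le> (norm (\<Sum>i\<in>S. h $ i *\<^sub>R column i A))\<^sup>2"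
    using e(1)[unfolded rip_bound_def submatrix_mult_def, rule_format, OF S] by blast
  have "P\<^sup>2 \<le> real t * (\<Sum>i\<in>V. (h $ i)\<^sup>2)"
    using Cauchy_Schwarz_ineq_sum[of "\<lambda>_. 1" "\<lambda>i. \<bar>h $ i\<bar>" V] V by (simp add: P_def)
  also have "\<dots> \<le> real t * (\<Sum>i\<in>S. (h $ i)\<^sup>2)"
    by (intro mult_left_mono sum_mono2) (auto simp: S_def)
  finally have "(1 - e) * P\<^sup>2 \<le> real t * ((1 - e) * (\<Sum>i\<in>S. (h $ i)\<^sup>2))"
    using e(2) by (simp add: mult_left_mono mult.left_commute)
  also have "\<dots> \<le> real t * ((1 + d) * Q\<^sup>2 / real K)"
    using low up by (intro mult_left_mono) auto
  finally have "real K * (1 - e) * P\<^sup>2 \<le> (real t * (1 + d)) * Q\<^sup>2"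
    using K by (simp add: field_simps)
  moreover have "real t * (1 + d) < real K * (1 - e)"
    using gap e(2) by (simp add: field_simps)
  \<comment> \<open>Needed for a strict conclusion: \<open>Q = 0\<close> would force
    \<open>P = 0\<close> and thus \<open>h = 0\<close>.\<close>
  moreover have "0 < Q"
  proof (rule ccontr)
    assume "\<not> 0 < Q"
    then have "Q = 0" using PQ by simp
    then have "real K * (1 - e) * P\<^sup>2 \<le> 0" using calculation(1) by simp
    then have "P = 0" using K e(2) by (simp add: mult_le_0_iff)
    have "h $ i = 0" for i
    proof (cases "i \<in> V")
      case True
      then show ?thesis using \<open>P = 0\<close> by (simp add: P_def sum_nonneg_eq_0_iff)
    next
      case False
      then show ?thesis using \<open>Q = 0\<close> by (simp add: Q_def sum_nonneg_eq_0_iff)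
    qed
    then show False using \<open>h \<noteq> 0\<close> by (simp add: vec_eq_iff)
  qed
  ultimately have "real K * (1 - e) * P\<^sup>2 < real K * (1 - e) * Q\<^sup>2"
    by (elim order_le_less_trans) (intro mult_strict_right_mono zero_less_power)
  moreover have "0 < real K * (1 - e)" using K e(2) by simp
  ultimately have "P\<^sup>2 < Q\<^sup>2" by (simp only: mult_less_cancel_left_pos)
  then show ?thesis using PQ(2) unfolding P_def Q_def by (rule power2_less_imp_less)
qed

section \<open>The fractional penalty\<close>

text \<open>The second factor is the slope of the chord from the origin; its monotonicity drives
  both subadditivity and the transfer from l1.\<close>

lemma frac_pen_eq_slope: "frac_pen a t = \<bar>t\<bar> * (a / (1 + a * \<bar>t\<bar>))"
  by (simp add: frac_pen_def)

lemma frac_pen_slope_antimono: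
  assumes "0 < a" "0 \<le> s" "s \<le> t"
  shows "a / (1 + a * t) \<le> a / (1 + a * (s::real))"
  using assms by (intro divide_left_mono mult_pos_pos add_left_mono mult_left_mono) (auto intro: add_pos_nonneg)

lemma frac_pen_mono:
  assumes "0 < a" "\<bar>s\<bar> \<le> \<bar>t\<bar>"
  shows "frac_pen a s \<le> frac_pen a t"
proof -
  have "0 < 1 + a * \<bar>s\<bar>" "0 < 1 + a * \<bar>t\<bar>" using assms by (auto intro: add_pos_nonneg)
  then show ?thesis using assms by (simp add: frac_pen_def field_simps)
qed

text \<open>Both summands are weighted by the slope at \<open>\<bar>s\<bar> + \<bar>t\<bar>\<close>,
  which is at most the slope at either argument alone.\<close>

lemma frac_pen_triangle:
  assumes "0 < a"
  shows "frac_pen a (s + t) \<le> frac_pen a s + frac_pen a t"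
proof -
  have "frac_pen a (s + t) \<le> frac_pen a (\<bar>s\<bar> + \<bar>t\<bar>)"
    using assms by (intro frac_pen_mono) auto
  also have "\<dots> = \<bar>s\<bar> * (a / (1 + a * (\<bar>s\<bar> + \<bar>t\<bar>))) + \<bar>t\<bar> * (a / (1 + a * (\<bar>s\<bar> + \<bar>t\<bar>)))"
    by (simp add: frac_pen_eq_slope distrib_right add_divide_distrib)
  also have "\<dots> \<le> frac_pen a s + frac_pen a t"
    unfolding frac_pen_eq_slope
    using assms by (intro add_mono mult_left_mono frac_pen_slope_antimono) auto
  finally show ?thesis .
qed

lemma frac_pen_null_space_property:
  fixes h :: "real ^ 'n"
  assumes a: "0 < a"
    and l1: "\<And>V. card V = card T \<Longrightarrow> (\<Sum>i\<in>V. \<bar>h $ i\<bar>) < (\<Sum>i\<in>-V. \<bar>h $ i\<bar>)"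
  shows "(\<Sum>i\<in>T. frac_pen a (h $ i)) < (\<Sum>i\<in>-T. frac_pen a (h $ i))"
proof -
  let ?F = "\<lambda>i. frac_pen a (h $ i)"
  obtain V \<tau> where V: "card V = card T" "0 \<le> \<tau>" "\<forall>i\<in>V. \<tau> \<le> \<bar>h $ i\<bar>" "\<forall>i\<in>UNIV - V. \<bar>h $ i\<bar> \<le> \<tau>"
    using exists_top_subset[of UNIV "card T" "\<lambda>i. \<bar>h $ i\<bar>"] by (auto simp: card_mono)
  \<comment> \<open>The slope at the threshold: slopes on \<open>V\<close> are at most
    \<open>q\<close>, those off \<open>V\<close> at least \<open>q\<close>, so the l1 inequality
    scaled by \<open>q\<close> fits between the two penalty sums.\<close>
  define q where "q = a / (1 + a * \<tau>)"
  have q: "0 < q" using a V(2) by (simp add: q_def add_pos_nonneg)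
  have top: "sum ?F T \<le> sum ?F V"
    by (rule sum_le_sum_top[where \<theta> = "frac_pen a \<tau>"]) (use V a in \<open>auto intro!: frac_pen_mono\<close>)
  \<comment> \<open>The total over all indices is fixed, so the comparison of \<open>T\<close> with
    \<open>V\<close> reverses on the complements.\<close>
  have compl: "sum ?F (-V) \<le> sum ?F (-T)"
    using top sum.subset_diff[of T UNIV ?F] sum.subset_diff[of V UNIV ?F]
    by (simp add: Compl_eq_Diff_UNIV)
  have "sum ?F V \<le> (\<Sum>i\<in>V. \<bar>h $ i\<bar> * q)"
    unfolding frac_pen_eq_slope q_def
    using V a by (intro sum_mono mult_left_mono frac_pen_slope_antimono) auto
  also have "\<dots> < (\<Sum>i\<in>-V. \<bar>h $ i\<bar> * q)"
    unfolding sum_distrib_right[symmetric] using l1[OF V(1)] q by simp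
  also have "\<dots> \<le> sum ?F (-V)"
    unfolding frac_pen_eq_slope q_def
    using V a by (intro sum_mono mult_left_mono frac_pen_slope_antimono) auto
  finally show ?thesis using top compl by linarith
qed

text \<open>On the support, passing from \<open>x0\<close> to \<open>x\<close> saves at most the
  penalty of \<open>x - x0\<close> there. Off the support \<open>x0\<close> vanishes, so the full
  penalty of \<open>x - x0\<close> is added.\<close>

lemma frac_penalty_less:
  fixes x x0 :: "real ^ 'n"
  assumes a: "0 < a"
    and nsp: "(\<Sum>i\<in>supp x0. frac_pen a ((x - x0) $ i)) < (\<Sum>i\<in>-supp x0. frac_pen a ((x - x0) $ i))"
  shows "frac_penalty a x0 < frac_penalty a x"
proof -
  let ?T = "supp x0"
  have split: "sum f UNIV = sum f ?T + sum f (-?T)" for f :: "'n \<Rightarrow> real"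
    using sum.subset_diff[of ?T UNIV f] by (simp add: Compl_eq_Diff_UNIV)
  have "frac_pen a (x0 $ i) \<le> frac_pen a (x $ i) + frac_pen a ((x - x0) $ i)" for i
    using frac_pen_triangle[OF a, of "x $ i" "x0 $ i - x $ i"]
    by (simp add: frac_pen_def abs_minus_commute)
  then have "(\<Sum>i\<in>?T. frac_pen a (x0 $ i))
      \<le> (\<Sum>i\<in>?T. frac_pen a (x $ i)) + (\<Sum>i\<in>?T. frac_pen a ((x - x0) $ i))"
    by (simp only: sum.distrib[symmetric] sum_mono)
  moreover have "(\<Sum>i\<in>-?T. frac_pen a ((x - x0) $ i)) = (\<Sum>i\<in>-?T. frac_pen a (x $ i))"
    by (rule sum.cong) (auto simp: supp_def)
  moreover have "(\<Sum>i\<in>-?T. frac_pen a (x0 $ i)) = 0"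
    by (rule sum.neutral) (auto simp: supp_def frac_pen_def)
  ultimately show ?thesis using nsp by (simp add: frac_penalty_def split)
qed

theorem theorem3:
  fixes A :: "real ^ 'n ^ 'm"
  assumes "CARD('m) < CARD('n)"
    and "rank A = CARD('m)"
  shows "\<exists>astar > 1. \<forall>(b :: real ^ 'm) (x0 :: real ^ 'n) (K :: nat).
    b \<noteq> 0 \<longrightarrow>
    optimal_P0 A b x0 \<longrightarrow>
    K > card (supp x0) \<longrightarrow>
    K + card (supp x0) \<le> CARD('m) \<longrightarrow>
    rip_const A (K + card (supp x0)) < 1 \<longrightarrow>
    real K > real (card (supp x0)) * ((1 + rip_const A K) / (1 - rip_const A (K + card (supp x0)))) \<longrightarrow>
    (\<forall>a. 1 < a \<and> a < astar \<longrightarrow>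
      (\<exists>!x. optimal_FP A b a x) \<and> (\<forall>xs. optimal_FP A b a xs \<longrightarrow> xs = x0))"
\<comment> \<open>The witness 2 is an arbitrary number above 1.\<close>
proof (intro exI[of _ 2] conjI allI impI)
  fix b :: "real ^ 'm" and x0 :: "real ^ 'n" and K :: nat and a :: real
  assume P0: "optimal_P0 A b x0" and K: "K > card (supp x0)"
    and rip: "rip_const A (K + card (supp x0)) < 1"
      "real K > real (card (supp x0)) * ((1 + rip_const A K) / (1 - rip_const A (K + card (supp x0))))"
    and a: "1 < a \<and> a < 2"
  have Ax0: "A *v x0 = b" using P0 by (simp add: optimal_P0_def is_arg_min_def)
  have less: "frac_penalty a x0 < frac_penalty a x" if "A *v x = b" "x \<noteq> x0" for x
  proof (rule frac_penalty_less)
    show "0 < a" using a by simp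
    have "A *v (x - x0) = 0" "x - x0 \<noteq> 0"
      using that Ax0 by (auto simp: matrix_vector_mult_diff_distrib)
    \<comment> \<open>\<open>K\<close> exceeds a cardinality, so both orders \<open>K\<close> and
      \<open>K + card (supp x0)\<close> are at least 1 and their \<open>rip_const\<close> is a true
      bound.\<close>
    then show "(\<Sum>i\<in>supp x0. frac_pen a ((x - x0) $ i)) < (\<Sum>i\<in>-supp x0. frac_pen a ((x - x0) $ i))"
      using \<open>0 < a\<close> K rip
      by (intro frac_pen_null_space_property rip_null_space_property[where A = A and K = K])
        (auto intro: rip_bound_rip_const)
  qed
  then have opt: "optimal_FP A b a x0"
    using Ax0 unfolding optimal_FP_def is_arg_min_def by (metis less_asym)
  have uniq: "xs = x0" if "optimal_FP A b a xs" for xs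
    using that less Ax0 unfolding optimal_FP_def is_arg_min_def by blast
  show "\<exists>!x. optimal_FP A b a x" using opt uniq by blast
  show "xs = x0" if "optimal_FP A b a xs" for xs using uniq that .
qed simp

end
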